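(* Let $T>0$, let $\varphi:\mathbb{R}\to\mathbb{R}$ be an odd homeomorphism, let $f:[0,T]\times\mathbb{R}\times\mathbb{R}\to\mathbb{R}$ be continuous, and let $b=-1$. Assume that the following conditions hold. 1. There exists a function $h\in C$ such that $|f(t,x,y)|\le h(t)$ for all $(t,x,y)\in[0,T]\times\mathbb{R}^2$. 2. There is a $\rho>0$ such that the Brouwer degree satisfies $\deg_B(G,B_\rho(0)\cap\mathbb{R}^2,0)\neq 0$. Then the problem $$(\varphi(u'))'=f(t,u,u'),\quad u'(0)=u(0),\quad u'(T)=-u'(0)$$ has at least one solution.
   Context: $C=C([0,T],\mathbb{R})$ carries the norm $\|\cdot\|_\infty$, and $C^1=C^1([0,T],\mathbb{R})$ carries the norm $\|u\|_1=\|u\|_\infty+\|u'\|_\infty$. A solution is a function $u\in C^1$ such that $\varphi(u')$ is continuously differentiable, $(\varphi(u'(t)))'=f(t,u(t),u'(t))$ for all $t\in[0,T]$, and the boundary conditions hold. $B_{\varphi,b}(x)=\varphi(bx)-\varphi(x)$ for $x\in\mathbb{R}$ (here with $b=-1$). The map $G:\mathbb{R}^2\to\mathbb{R}^2$ is $$G(x,y)=\left(\frac{B_{\varphi,b}(x)}{T}-\frac1T\int_0^T f(t,x+yt,y)\,dt,\ -x+y\right).$$ $B_\rho(0)$ is the open ball of $C^1$ with center $0$ and radius $\rho$, and $\mathbb{R}^2$ is identified with the affine functions in $C^1$ via $(x,y)\approx x+yt$, so $B_\rho(0)\cap\mathbb{R}^2=\{(x,y): \max_{t\in[0,T]}|x+yt|+|y|<\rho\}$.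 $\deg_B$ denotes the Brouwer degree (in condition 2 it is assumed to be well defined). *)

theory Defs
  imports "HOL-Analysis.Analysis"
begin

section \<open>Brouwer degree\<close>

text \<open>
  The degree \<open>deg(F, U, p)\<close> is defined for \<open>U\<close> open and bounded, \<open>F\<close> continuous on the
  closure of \<open>U\<close>, and \<open>p\<close> not in the image of the boundary of \<open>U\<close>.
\<close>

definition brouwer_degree_defined ::
    "(real ^ 'n \<Rightarrow> real ^ 'n) \<Rightarrow> (real ^ 'n) set \<Rightarrow> real ^ 'n \<Rightarrow> bool" where
  "brouwer_degree_defined F U p \<longleftrightarrow>
     open U \<and> bounded U \<and> continuous_on (closure U) F \<and> p \<notin> F ` frontier U"

text \<open>
  \<open>g\<close> is continuous on the closure of \<open>U\<close> and continuously differentiable on \<open>U\<close>, and \<open>p\<close>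
  is a regular value of \<open>g\<close> on \<open>U\<close>.
\<close>

definition C1_regular_at_value ::
    "(real ^ 'n \<Rightarrow> real ^ 'n) \<Rightarrow> (real ^ 'n) set \<Rightarrow> real ^ 'n \<Rightarrow> bool" where
  "C1_regular_at_value g U p \<longleftrightarrow>
     continuous_on (closure U) g \<and>
     (\<forall>x\<in>U. g differentiable (at x)) \<and>
     continuous_on U (\<lambda>x. jacobian g (at x)) \<and>
     (\<forall>x\<in>U. g x = p \<longrightarrow> det (jacobian g (at x)) \<noteq> 0)"

text \<open>
  The usual analytic definition: the degree of \<open>F\<close> is the sum of the signs of the Jacobian
  determinants over the preimages of \<open>p\<close>, for any continuously differentiable \<open>g\<close> with regular
  value \<open>p\<close> and \<open>sup {|g x - F x| : x in closure U} < dist(p, F(boundary U))\<close>. The closure and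
  the boundary of \<open>U\<close> are compact, so this inequality is expressed pointwise; unlike
  \<^const>\<open>infdist\<close>, which is \<open>0\<close> for the empty set, this is also right for empty \<open>U\<close>.
  Such \<open>g\<close> exist by the Weierstrass and Sard theorems, the set of preimages is
  finite, and the sum does not depend on \<open>g\<close>.
\<close>

definition brouwer_degree ::
    "(real ^ 'n \<Rightarrow> real ^ 'n) \<Rightarrow> (real ^ 'n) set \<Rightarrow> real ^ 'n \<Rightarrow> int" where
  "brouwer_degree F U p =
     (THE d. \<exists>g. C1_regular_at_value g U p \<and>
        (\<forall>x\<in>closure U. \<forall>y\<in>frontier U. dist (g x) (F x) < dist (F y) p) \<and>
        real_of_int d = (\<Sum>x | x \<in> U \<and> g x = p. sgn (det (jacobian g (at x)))))"


section \<open>The space of continuously differentiable functions on a compact interval\<close>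

text \<open>
  Functions on \<open>[0,T]\<close> are represented by functions on the reals; only their values on
  \<open>[0,T]\<close> matter, and the derivative at the end points is one-sided.
\<close>

definition deriv_on :: "real \<Rightarrow> (real \<Rightarrow> real) \<Rightarrow> real \<Rightarrow> real" where
  "deriv_on T u t = vector_derivative u (at t within {0..T})"

definition C1_on :: "real \<Rightarrow> (real \<Rightarrow> real) \<Rightarrow> bool" where
  "C1_on T u \<longleftrightarrow> u differentiable_on {0..T} \<and> continuous_on {0..T} (deriv_on T u)"

definition sup_norm :: "real \<Rightarrow> (real \<Rightarrow> real) \<Rightarrow> real" where
  "sup_norm T u = (SUP t\<in>{0..T}. \<bar>u t\<bar>)"

definition C1_norm :: "real \<Rightarrow> (real \<Rightarrow> real) \<Rightarrow> real" where
  "C1_norm T u = sup_norm T u + sup_norm T (deriv_on T u)"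

text \<open>
  The intersection of the open \<open>C\<^sup>1\<close>-ball of radius \<open>\<rho>\<close> about \<open>0\<close> with the plane of affine
  functions, where \<open>z\<close> stands for \<open>t \<mapsto> z $ 1 + z $ 2 * t\<close>.
\<close>

definition affine_ball :: "real \<Rightarrow> real \<Rightarrow> (real ^ 2) set" where
  "affine_ball T \<rho> = {z. C1_norm T (\<lambda>t. z $ 1 + z $ 2 * t) < \<rho>}"

lemma C1_norm_affine:
  assumes "T > 0"
  shows "C1_norm T (\<lambda>t. x + y * t) = (SUP t\<in>{0..T}. \<bar>x + y * t\<bar>) + \<bar>y\<bar>"
proof -
  have "deriv_on T (\<lambda>t. x + y * t) t = y" if "t \<in> {0..T}" for t
    unfolding deriv_on_def
  proof (rule vector_derivative_within_cbox[of 0 T, unfolded box_real])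
    show "((\<lambda>t. x + y * t) has_vector_derivative y) (at t within {0..T})"
      unfolding has_real_derivative_iff_has_vector_derivative[symmetric]
      by (auto intro!: derivative_eq_intros)
  qed (use assms that in auto)
  then have "sup_norm T (deriv_on T (\<lambda>t. x + y * t)) = (SUP t\<in>{0..T}. \<bar>y\<bar>)"
    unfolding sup_norm_def by (intro SUP_cong) auto
  also have "\<dots> = \<bar>y\<bar>"
    using assms by simp
  finally show ?thesis
    by (simp add: C1_norm_def sup_norm_def)
qed


section \<open>The boundary value problem\<close>

definition B_map :: "(real \<Rightarrow> real) \<Rightarrow> real \<Rightarrow> real \<Rightarrow> real" where
  "B_map \<phi> b x = \<phi> (b * x) - \<phi> x"

definition G_map ::
    "real \<Rightarrow> (real \<Rightarrow> real) \<Rightarrow> real \<Rightarrow> (real \<Rightarrow> real \<Rightarrow> real \<Rightarrow> real) \<Rightarrow> real ^ 2 \<Rightarrow> real ^ 2" where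
  "G_map T \<phi> b f z =
     (let x = z $ 1; y = z $ 2
      in vector [B_map \<phi> b x / T - 1 / T * integral {0..T} (\<lambda>t. f t (x + y * t) y), - x + y])"

definition is_solution ::
    "real \<Rightarrow> (real \<Rightarrow> real) \<Rightarrow> real \<Rightarrow> (real \<Rightarrow> real \<Rightarrow> real \<Rightarrow> real) \<Rightarrow> (real \<Rightarrow> real) \<Rightarrow> bool" where
  "is_solution T \<phi> b f u \<longleftrightarrow>
     C1_on T u \<and> C1_on T (\<lambda>t. \<phi> (deriv_on T u t)) \<and>
     (\<forall>t\<in>{0..T}. deriv_on T (\<lambda>s. \<phi> (deriv_on T u s)) t = f t (u t) (deriv_on T u t)) \<and>
     deriv_on T u 0 = u 0 \<and> deriv_on T u T = b * deriv_on T u 0"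

end

theory Submission
  imports Defs "HOL-Complex_Analysis.Great_Picard"
begin

text \<open>
  Since \<open>b = -1\<close> and \<open>\<phi>\<close> is odd, the problem says, for \<open>w = \<phi> \<circ> u'\<close>, that \<open>u' = \<phi>\<inverse> \<circ> w\<close>,
  \<open>w' = f(t, u, \<phi>\<inverse> \<circ> w)\<close>, \<open>u(0) = \<phi>\<inverse>(w(0))\<close> and \<open>w(T) + w(0) = 0\<close>. Let \<open>M\<close> bound \<open>f\<close>. Along
  an Euler polygon started at \<open>w(0) = c\<close>, the sum \<open>w(T) + c\<close> depends continuously on \<open>c\<close> and
  differs from \<open>2c\<close> by at most \<open>M T\<close>, so it vanishes for some \<open>c\<close> in \<open>[-M T, M T]\<close>. The polygons
  obtained in this way are uniformly bounded and equicontinuous, and by the Arzela-Ascoli theorem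
  a subsequence converges to a solution.
\<close>

section \<open>Piecewise linear interpolation\<close>

text \<open>For \<open>h \<ge> 0\<close> and \<open>t \<ge> 0\<close> this is the length of the part
  of the cell \<open>[h k, h (k + 1)]\<close> lying to the left of \<open>t\<close>.\<close>

definition ramp :: "real \<Rightarrow> nat \<Rightarrow> real \<Rightarrow> real" where
  "ramp h k t = max 0 (min h (t - h * k))"

text \<open>
  The primitive, with value \<open>0\<close> at \<open>0\<close>, of the step function with value \<open>c k\<close> on
  \<open>[h k, h (k + 1)]\<close> for \<open>k < N\<close>.
\<close>

definition polygon :: "real \<Rightarrow> nat \<Rightarrow> (nat \<Rightarrow> real) \<Rightarrow> real \<Rightarrow> real" where
  "polygon h N c t = (\<Sum>k<N. c k * ramp h k t)"

text \<open>The first \<open>N\<close> cells tile \<open>[0, h N]\<close>, so the covered lengths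
  add up. Increments of ramps thereby become weights with a known total.\<close>

lemma sum_ramp:
  fixes h t :: real and N :: nat
  assumes "h \<ge> 0" "t \<ge> 0"
  shows "(\<Sum>k<N. ramp h k t) = min t (h * N)"
  using assms by (induction N) (auto simp: ramp_def algebra_simps min_def max_def)

lemma ramp_mono: "s \<le> t \<Longrightarrow> ramp h k s \<le> ramp h k t"
  by (auto simp: ramp_def)

text \<open>At a node every ramp is either complete or still zero, so the polygon takes there the
  partial sums that an Euler scheme produces.\<close>

lemma polygon_node:
  assumes "h \<ge> 0" "j \<le> N"
  shows "polygon h N c (h * j) = (\<Sum>k<j. h * c k)"
proof -
  have ramp: "ramp h k (h * j) = (if k < j then h else 0)" for k
  proof (cases "k < j")
    case True
    then have "h * 1 \<le> h * (real j - real k)"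
      using assms by (intro mult_left_mono) auto
    with True assms show ?thesis
      by (auto simp: ramp_def algebra_simps)
  next
    case False
    then have "h * j \<le> h * k"
      using assms by (intro mult_left_mono) auto
    with False assms show ?thesis
      by (auto simp: ramp_def)
  qed
  have "polygon h N c (h * j) = (\<Sum>k<N. if k \<in> {..<j} then h * c k else 0)"
    unfolding polygon_def ramp by (intro sum.cong) auto
  also have "\<dots> = (\<Sum>k\<in>{..<N} \<inter> {..<j}. h * c k)"
    by (rule sum.inter_restrict[symmetric]) simp
  also have "{..<N} \<inter> {..<j} = {..<j}"
    using assms by auto
  finally show ?thesis .
qed

text \<open>The increments of the ramps from \<open>s\<close> to \<open>t\<close> are nonnegative
  weights with sum \<open>t - s\<close>, and only cells touching \<open>[s, t]\<close> get positive
  weight. With \<open>a = 0\<close> this yields a Lipschitz bound; with \<open>a\<close> the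
  expected derivative it yields differentiability of limits.\<close>

lemma polygon_increment:
  fixes h s t :: real and N :: nat
  assumes "h \<ge> 0" "0 \<le> s" "s \<le> t" "t \<le> h * N"
    and c: "\<And>k. k < N \<Longrightarrow> h * k \<le> t \<Longrightarrow> s \<le> h * Suc k \<Longrightarrow> \<bar>c k - a\<bar> \<le> e"
  shows "\<bar>polygon h N c t - polygon h N c s - a * (t - s)\<bar> \<le> e * (t - s)"
proof -
  let ?d = "\<lambda>k. ramp h k t - ramp h k s"
  have sum_d: "(\<Sum>k<N. ?d k) = t - s"
    using assms by (simp add: sum_subtractf sum_ramp)
  have "polygon h N c t - polygon h N c s - a * (t - s) = (\<Sum>k<N. (c k - a) * ?d k)"
    unfolding sum_d[symmetric] polygon_def
    by (simp add: sum_distrib_left sum_subtractf sum.distrib algebra_simps)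
  also have "\<bar>\<dots>\<bar> \<le> (\<Sum>k<N. e * ?d k)"
  proof (rule order_trans[OF sum_abs], rule sum_mono)
    fix k assume k: "k \<in> {..<N}"
    have d: "?d k \<ge> 0"
      using ramp_mono assms(3) by simp
    show "\<bar>(c k - a) * ?d k\<bar> \<le> e * ?d k"
    \<comment> \<open>A slope of weight zero may be arbitrary; otherwise the cell touches
      \<open>[s, t]\<close> and the assumption \<open>c\<close> applies.\<close>
    proof (cases "?d k = 0")
      case False
      then have "h * k \<le> t" "s \<le> h * Suc k"
        using assms(1,3) by (auto simp: ramp_def algebra_simps max_def min_def split: if_splits)
      with c k have "\<bar>c k - a\<bar> \<le> e"
        by simp
      with d show ?thesis
        by (simp add: abs_mult mult_right_mono)
    qed (use d in simp)
  qed
  also have "\<dots> = e * (t - s)"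
    by (simp add: sum_distrib_left[symmetric] sum_d)
  finally show ?thesis .
qed

lemma polygon_lipschitz:
  fixes h s t :: real and N :: nat
  assumes "h \<ge> 0" "s \<in> {0..h * N}" "t \<in> {0..h * N}" "\<And>k. k < N \<Longrightarrow> \<bar>c k\<bar> \<le> M"
  shows "\<bar>polygon h N c t - polygon h N c s\<bar> \<le> M * \<bar>t - s\<bar>"
proof (cases "s \<le> t")
  case True
  with polygon_increment[of h s t N c 0 M] assms show ?thesis by auto
next
  case False
  with polygon_increment[of h t s N c 0 M] assms show ?thesis
    by (auto simp: abs_minus_commute)
qed

text \<open>Close to \<open>x\<close> and for large \<open>n\<close>, all slopes of the polygons are
  near \<open>G x\<close>, and the resulting estimate on increments survives pointwise limits. The
  limit is thus differentiated directly, without an integral equation.\<close>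

lemma polygon_limit_has_derivative:
  fixes F :: "nat \<Rightarrow> real \<Rightarrow> real" and h :: "nat \<Rightarrow> real" and N :: "nat \<Rightarrow> nat"
  assumes h: "\<And>n. h n \<ge> 0" "\<And>n. h n * N n = T" "h \<longlonglongrightarrow> 0"
    and F: "uniform_limit {0..T} F G sequentially"
    and G: "continuous_on {0..T} G"
    and S: "\<And>t. t \<in> {0..T} \<Longrightarrow> (\<lambda>n. polygon (h n) (N n) (\<lambda>k. F n (h n * k)) t) \<longlonglongrightarrow> S t"
    and x: "x \<in> {0..T}"
  shows "(S has_real_derivative G x) (at x within {0..T})"
proof -
  have small: "\<exists>d>0. \<forall>y\<in>{0..T}. \<bar>y - x\<bar> < d \<longrightarrow> \<bar>S y - S x - G x * (y - x)\<bar> \<le> e * \<bar>y - x\<bar>"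
    if "e > 0" for e
  proof -
    \<comment> \<open>One half of \<open>e\<close> pays for the variation of \<open>G\<close> near
      \<open>x\<close>, the other for the distance from \<open>F n\<close> to
      \<open>G\<close>.\<close>
    from \<open>e > 0\<close> have "e / 2 > 0" by simp
    with G x obtain d where "d > 0"
      and d: "\<And>y. y \<in> {0..T} \<Longrightarrow> \<bar>y - x\<bar> < d \<Longrightarrow> \<bar>G y - G x\<bar> < e / 2"
      unfolding continuous_on_iff dist_real_def by blast
    have near: "\<forall>\<^sub>F n in sequentially. \<forall>y\<in>{0..T}. \<bar>F n y - G y\<bar> < e / 2"
      using F \<open>e / 2 > 0\<close> unfolding uniform_limit_iff dist_real_def by blast
    \<comment> \<open>A cell touching \<open>[s, t]\<close> may have its left node up to
      \<open>h n\<close> before \<open>s\<close>; together with \<open>t - s < d / 2\<close> this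
      keeps the node within \<open>d\<close> of \<open>x\<close>.\<close>
    have step: "\<forall>\<^sub>F n in sequentially. h n < d / 2"
      using h(3) \<open>d > 0\<close> by (intro order_tendstoD(2)[of h 0]) auto
    have incr: "\<bar>S t - S s - G x * (t - s)\<bar> \<le> e * (t - s)"
      if st: "s \<in> {0..T}" "t \<in> {0..T}" "s \<le> t" "x = s \<or> x = t" "t - s < d / 2" for s t
    proof -
      let ?P = "\<lambda>n. polygon (h n) (N n) (\<lambda>k. F n (h n * k))"
      have lim: "(\<lambda>n. \<bar>?P n t - ?P n s - G x * (t - s)\<bar>) \<longlonglongrightarrow> \<bar>S t - S s - G x * (t - s)\<bar>"
        by (intro tendsto_intros S st)
      have "\<forall>\<^sub>F n in sequentially. \<bar>?P n t - ?P n s - G x * (t - s)\<bar> \<le> e * (t - s)"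
        using near step
      proof eventually_elim
        case (elim n)
        show ?case
        proof (rule polygon_increment)
          fix k assume k: "k < N n" "h n * k \<le> t" "s \<le> h n * Suc k"
          have "h n * k \<le> h n * N n"
            using k h(1)[of n] by (intro mult_left_mono) auto
          then have node: "h n * k \<in> {0..T}"
            using h(1,2)[of n] by auto
          have "\<bar>h n * k - x\<bar> < d"
            using k st elim(2) by (auto simp: algebra_simps)
          with node d have "\<bar>G (h n * k) - G x\<bar> < e / 2"
            by blast
          moreover have "\<bar>F n (h n * k) - G (h n * k)\<bar> < e / 2"
            using node elim(1) by blast
          ultimately show "\<bar>F n (h n * k) - G x\<bar> \<le> e"
            by linarith
        qed (use st h(1,2)[of n] in auto)
      qed
      with lim show ?thesis
        by (intro tendsto_upperbound[OF lim]) auto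
    qed
    have "\<bar>S y - S x - G x * (y - x)\<bar> \<le> e * \<bar>y - x\<bar>" if "y \<in> {0..T}" "\<bar>y - x\<bar> < d / 2" for y
    proof (cases "x \<le> y")
      case True
      then show ?thesis using incr[of x y] that x by auto
    next
      case False
      then have "\<bar>S x - S y - G x * (x - y)\<bar> \<le> e * (x - y)"
        using incr[of y x] that x by auto
      moreover have "S y - S x - G x * (y - x) = - (S x - S y - G x * (x - y))"
        by (simp add: algebra_simps)
      ultimately show ?thesis
        using False by (simp only: abs_minus_cancel) simp
    qed
    with \<open>d > 0\<close> show ?thesis
      by (intro exI[of _ "d / 2"]) auto
  qed
  show ?thesis
    unfolding has_field_derivative_def has_derivative_within_alt
    using small by (auto simp: bounded_linear_mult_right)
qed


section \<open>Euler polygons\<close>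

context
  fixes T M :: real and f :: "real \<Rightarrow> real \<Rightarrow> real \<Rightarrow> real" and \<psi> :: "real \<Rightarrow> real"
  assumes T: "T > 0"
    and f: "continuous_on ({0..T} \<times> UNIV \<times> UNIV) (\<lambda>(t, x, y). f t x y)"
    and bound: "\<And>t x y. t \<in> {0..T} \<Longrightarrow> \<bar>f t x y\<bar> \<le> M"
    and \<psi>: "continuous_on UNIV \<psi>"
begin

lemma M_nonneg: "M \<ge> 0"
  using bound[of 0 0 0] T by auto

text \<open>Explicit Euler scheme for the pair \<open>(u, w)\<close> with
  \<open>u' = \<psi>(w)\<close> and \<open>w' = f(t, u, \<psi>(w))\<close>, where
  \<open>\<psi>\<close> will be the inverse of \<open>\<phi>\<close>. The start builds in
  \<open>u(0) = u'(0)\<close>, so \<open>c\<close> is the only free parameter.\<close>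

primrec euler :: "real \<Rightarrow> real \<Rightarrow> nat \<Rightarrow> real \<times> real" where
  "euler h c 0 = (\<psi> c, c)"
| "euler h c (Suc k) =
     (fst (euler h c k) + h * \<psi> (snd (euler h c k)),
      snd (euler h c k) + h * f (h * k) (fst (euler h c k)) (\<psi> (snd (euler h c k))))"

lemma euler_fst: "fst (euler h c j) = \<psi> c + (\<Sum>k<j. h * \<psi> (snd (euler h c k)))"
  by (induction j) auto

lemma euler_snd:
  "snd (euler h c j) = c + (\<Sum>k<j. h * f (h * k) (fst (euler h c k)) (\<psi> (snd (euler h c k))))"
  by (induction j) auto

lemma node_mem:
  fixes h :: real and N k :: nat
  assumes "h \<ge> 0" "h * N = T" "k \<le> N"
  shows "h * real k \<in> {0..T}"
proof -
  have "h * k \<le> h * N"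
    using assms by (intro mult_left_mono) auto
  with assms show ?thesis by auto
qed

lemma continuous_on_euler:
  fixes h :: real and N k :: nat
  assumes "h \<ge> 0" "h * N = T" "k \<le> N"
  shows "continuous_on UNIV (\<lambda>c. euler h c k)"
  using \<open>k \<le> N\<close>
proof (induction k)
  case 0
  show ?case using \<psi> by (auto intro!: continuous_intros)
next
  case (Suc k)
  then have IH: "continuous_on UNIV (\<lambda>c. euler h c k)" by simp
  have \<psi>': "continuous_on UNIV (\<lambda>c. \<psi> (snd (euler h c k)))"
    by (rule continuous_on_compose2[OF \<psi>]) (auto intro!: continuous_intros IH)
  have "continuous_on UNIV
      (\<lambda>c. case (h * k, fst (euler h c k), \<psi> (snd (euler h c k))) of (t, x, y) \<Rightarrow> f t x y)"
    using node_mem[OF assms(1,2), of k] Suc.prems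
    by (intro continuous_on_compose2[OF f] continuous_intros IH \<psi>') auto
  then show ?case
    by (auto intro!: continuous_intros IH \<psi>')
qed

text \<open>Shooting for the discrete antiperiodic condition. The bound on \<open>c\<close> does not
  depend on the step size, which later gives compactness.\<close>

lemma euler_shooting:
  fixes h :: real and N :: nat
  assumes "h \<ge> 0" "h * N = T"
  obtains c where "\<bar>c\<bar> \<le> M * T" "snd (euler h c N) = - c"
proof -
  have near: "\<bar>snd (euler h c N) - c\<bar> \<le> M * T" for c
  proof -
    have "\<bar>snd (euler h c N) - c\<bar>
        \<le> (\<Sum>k<N. \<bar>h * f (h * k) (fst (euler h c k)) (\<psi> (snd (euler h c k)))\<bar>)"
      unfolding euler_snd[of h c N] by (simp add: sum_abs)
    also have "\<dots> \<le> (\<Sum>k<N. h * M)"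
      using assms node_mem[OF assms] bound
      by (intro sum_mono) (auto simp: abs_mult intro!: mult_left_mono)
    also have "\<dots> = M * T"
      using assms by auto
    finally show ?thesis .
  qed
  have MT: "M * T \<ge> 0"
    using M_nonneg T by auto
  \<comment> \<open>By \<open>near\<close>, the end value is at least \<open>0\<close> for
    \<open>c = M * T\<close> and at most \<open>0\<close> for \<open>c = - (M * T)\<close>.\<close>
  have "\<exists>c\<ge>- (M * T). c \<le> M * T \<and> snd (euler h c N) + c = 0"
  proof (rule IVT')
    show "continuous_on {- (M * T)..M * T} (\<lambda>c. snd (euler h c N) + c)"
      by (intro continuous_intros continuous_on_subset[OF continuous_on_euler[OF assms]]) auto
  qed (use MT near[of "M * T"] near[of "- (M * T)"] in linarith)+
  then obtain c where "c \<ge> - (M * T)" "c \<le> M * T" "snd (euler h c N) + c = 0" by blast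
  then show ?thesis
    by (intro that[of c]) linarith+
qed

text \<open>The interpolants agree with the Euler values at the nodes, so the slopes can be
  expressed through \<open>U\<close> and \<open>W\<close> themselves. This is the form that
  \<open>polygon_limit_has_derivative\<close> expects: slopes sampled from a function at left
  nodes.\<close>

lemma euler_polygon:
  fixes h :: real and N :: nat
  assumes "h \<ge> 0" "h * N = T"
  obtains U W :: "real \<Rightarrow> real" where
    "\<bar>W 0\<bar> \<le> M * T" "W T = - W 0" "U 0 = \<psi> (W 0)"
    "\<And>t. W t = W 0 + polygon h N (\<lambda>k. f (h * k) (U (h * k)) (\<psi> (W (h * k)))) t"
    "\<And>t. U t = U 0 + polygon h N (\<lambda>k. \<psi> (W (h * k))) t"
proof -
  obtain c where c: "\<bar>c\<bar> \<le> M * T" "snd (euler h c N) = - c"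
    using euler_shooting[OF assms] .
  define p where "p = euler h c"
  define W where "W t = c + polygon h N (\<lambda>k. f (h * k) (fst (p k)) (\<psi> (snd (p k)))) t" for t
  define U where "U t = \<psi> c + polygon h N (\<lambda>k. \<psi> (snd (p k))) t" for t
  have W_node: "W (h * k) = snd (p k)" and U_node: "U (h * k) = fst (p k)" if "k \<le> N" for k
    using that assms(1) euler_snd[of h c k] euler_fst[of h c k]
    by (simp_all add: W_def U_def p_def polygon_node)
  have start: "W 0 = c" "U 0 = \<psi> c"
    using W_node[of 0] U_node[of 0] by (simp_all add: p_def)
  have "polygon h N (\<lambda>k. f (h * k) (U (h * k)) (\<psi> (W (h * k)))) t
      = polygon h N (\<lambda>k. f (h * k) (fst (p k)) (\<psi> (snd (p k)))) t" for t
    unfolding polygon_def by (intro sum.cong) (auto simp: W_node U_node)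
  moreover have "polygon h N (\<lambda>k. \<psi> (W (h * k))) t = polygon h N (\<lambda>k. \<psi> (snd (p k))) t" for t
    unfolding polygon_def by (intro sum.cong) (auto simp: W_node)
  moreover have "W T = - c"
    using W_node[of N] assms c by (simp add: p_def)
  ultimately show ?thesis
    using that[of W U] c start by (simp add: W_def U_def)
qed

lemma antiperiodic_system_solvable:
  obtains U W :: "real \<Rightarrow> real" where
    "U 0 = \<psi> (W 0)" "W T = - W 0"
    "\<And>t. t \<in> {0..T} \<Longrightarrow> (U has_real_derivative \<psi> (W t)) (at t within {0..T})"
    "\<And>t. t \<in> {0..T} \<Longrightarrow> (W has_real_derivative f t (U t) (\<psi> (W t))) (at t within {0..T})"
proof -

  \<comment> \<open>Approximate solutions on ever finer grids\<close>
  define h where "h n = T / real (Suc n)" for n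
  have h: "h n \<ge> 0" "h n * Suc n = T" for n
    using T by (auto simp: h_def field_simps)
  have h_lim: "h \<longlonglongrightarrow> 0"
    unfolding h_def by (intro LIMSEQ_Suc[OF lim_const_over_n])
  define approx where "approx n U W \<longleftrightarrow> \<bar>W 0\<bar> \<le> M * T \<and> W T = - W 0 \<and> U 0 = \<psi> (W 0) \<and>
      (\<forall>t. W t = W 0 + polygon (h n) (Suc n) (\<lambda>k. f (h n * k) (U (h n * k)) (\<psi> (W (h n * k)))) t) \<and>
      (\<forall>t. U t = U 0 + polygon (h n) (Suc n) (\<lambda>k. \<psi> (W (h n * k))) t)"
    for n and U W :: "real \<Rightarrow> real"
  have "\<exists>U W. approx n U W" for n
  proof (rule euler_polygon[OF h[of n]])
    fix U W :: "real \<Rightarrow> real"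
    assume "\<bar>W 0\<bar> \<le> M * T" "W T = - W 0" "U 0 = \<psi> (W 0)"
      "\<And>t. W t = W 0 + polygon (h n) (Suc n) (\<lambda>k. f (h n * k) (U (h n * k)) (\<psi> (W (h n * k)))) t"
      "\<And>t. U t = U 0 + polygon (h n) (Suc n) (\<lambda>k. \<psi> (W (h n * k))) t"
    then have "approx n U W"
      unfolding approx_def by blast
    then show ?thesis by blast
  qed
  then obtain U W where approx: "\<And>n. approx n (U n) (W n)"
    by metis
  have W0: "\<bar>W n 0\<bar> \<le> M * T" and WT: "W n T = - W n 0" and U0: "U n 0 = \<psi> (W n 0)"
    and W: "W n t = W n 0 +
      polygon (h n) (Suc n) (\<lambda>k. f (h n * k) (U n (h n * k)) (\<psi> (W n (h n * k)))) t"
    and U: "U n t = U n 0 + polygon (h n) (Suc n) (\<lambda>k. \<psi> (W n (h n * k))) t" for n t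
    using approx[of n] unfolding approx_def by blast+

  \<comment> \<open>Uniform bounds and Lipschitz estimates\<close>
  have node: "h n * real k \<in> {0..T}" if "k < Suc n" for n k
    using node_mem[OF h] that by simp
  have W_lip: "\<bar>W n t - W n s\<bar> \<le> M * \<bar>t - s\<bar>" if "s \<in> {0..T}" "t \<in> {0..T}" for n s t
    unfolding W[of n t] W[of n s] add_diff_cancel_left
    using that by (intro polygon_lipschitz h bound node) (simp_all only: h)
  \<comment> \<open>\<open>W n\<close> starts within \<open>M * T\<close> of zero and drifts by at
    most \<open>M * T\<close>.\<close>
  define R where "R = 2 * M * T"
  have W_bound: "W n t \<in> {-R..R}" if "t \<in> {0..T}" for n t
  proof -
    have "M * \<bar>t - 0\<bar> \<le> M * T"
      using that M_nonneg by (intro mult_left_mono) auto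
    then show ?thesis
      using W_lip[of 0 t n] W0[of n] that T by (auto simp: R_def)
  qed
  \<comment> \<open>Since \<open>\<psi>\<close> may be unbounded, its bound \<open>K\<close> is
    taken on the range just secured for \<open>W n\<close>; it then bounds the slopes of
    \<open>U n\<close>.\<close>
  have "compact (\<psi> ` {-R..R})"
    by (intro compact_continuous_image continuous_on_subset[OF \<psi>]) auto
  then obtain K where K: "\<And>w. w \<in> {-R..R} \<Longrightarrow> \<bar>\<psi> w\<bar> \<le> K"
    using compact_imp_bounded[of "\<psi> ` {-R..R}"] unfolding bounded_iff real_norm_def by blast
  have "K \<ge> 0"
    using K[OF W_bound[of 0 0]] T by simp
  have U_lip: "\<bar>U n t - U n s\<bar> \<le> K * \<bar>t - s\<bar>" if "s \<in> {0..T}" "t \<in> {0..T}" for n s t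
    unfolding U[of n t] U[of n s] add_diff_cancel_left
    using that by (intro polygon_lipschitz h K W_bound node) (simp_all only: h)
  \<comment> \<open>The first \<open>K\<close> bounds the start \<open>\<psi> (W n 0)\<close>, and
    \<open>K * T\<close> bounds the drift.\<close>
  define R' where "R' = K + K * T"
  have U_bound: "U n t \<in> {-R'..R'}" if "t \<in> {0..T}" for n t
  proof -
    have "K * \<bar>t - 0\<bar> \<le> K * T"
      using that \<open>K \<ge> 0\<close> by (intro mult_left_mono) auto
    moreover have "\<bar>U n 0\<bar> \<le> K"
      using U0[of n] K W_bound[of 0 n] T by simp
    ultimately show ?thesis
      using U_lip[of 0 t n] that T by (auto simp: R'_def)
  qed

  \<comment> \<open>Extraction of a convergent subsequence\<close>
  define Z where "Z n t = (t, U n t, W n t)" for n t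
  define B where "B = {0..T} \<times> {-R'..R'} \<times> {-R..R}"
  have "compact B"
    unfolding B_def by (intro compact_Times) auto
  have Z_mem: "Z n t \<in> B" if "t \<in> {0..T}" for n t
    using U_bound[OF that] W_bound[OF that] that by (auto simp: Z_def B_def)
  obtain b where b: "\<And>z. z \<in> B \<Longrightarrow> norm z \<le> b"
    using compact_imp_bounded[OF \<open>compact B\<close>] unfolding bounded_iff by auto
  \<comment> \<open>The sum of the Lipschitz constants of the three components of
    \<open>Z n\<close>.\<close>
  define L where "L = 1 + (K + M)"
  have "L > 0"
    using \<open>K \<ge> 0\<close> M_nonneg by (simp add: L_def)
  have Z_lip: "norm (Z n s - Z n t) \<le> L * \<bar>s - t\<bar>" if "s \<in> {0..T}" "t \<in> {0..T}" for n s t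
  proof -
    have "norm (Z n s - Z n t) \<le> \<bar>s - t\<bar> + (\<bar>U n s - U n t\<bar> + \<bar>W n s - W n t\<bar>)"
      unfolding Z_def diff_Pair
      by (intro order_trans[OF norm_Pair_le] add_mono) (auto intro: order_trans[OF norm_Pair_le])
    also have "\<dots> \<le> L * \<bar>s - t\<bar>"
      using U_lip[OF that(2,1), of n] W_lip[OF that(2,1), of n] by (simp add: L_def algebra_simps)
    finally show ?thesis .
  qed
  \<comment> \<open>Applied to the triple, the theorem gives one subsequence along which both
    \<open>U\<close> and \<open>W\<close> converge.\<close>
  obtain Y r where Y: "continuous_on {0..T} Y" and r: "strict_mono (r :: nat \<Rightarrow> nat)"
    and lim: "\<And>e. 0 < e \<Longrightarrow> \<exists>N. \<forall>n x. n \<ge> N \<and> x \<in> {0..T} \<longrightarrow> norm (Z (r n) x - Y x) < e"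
  proof (rule Arzela_Ascoli[of "{0..T}" Z b])
    fix x e :: real assume "x \<in> {0..T}" "0 < e"
    have "norm (Z n x - Z n y) < e" if "y \<in> {0..T}" "norm (x - y) < e / L" for n y
      using Z_lip[OF \<open>x \<in> {0..T}\<close> that(1), of n] that(2) \<open>L > 0\<close> by (simp add: field_simps)
    with \<open>0 < e\<close> \<open>L > 0\<close>
    show "\<exists>d>0. \<forall>n y. y \<in> {0..T} \<and> norm (x - y) < d \<longrightarrow> norm (Z n x - Z n y) < e"
      by (intro exI[of _ "e / L"]) auto
  qed (use Z_mem b in auto)
  have Z_lim: "uniform_limit {0..T} (\<lambda>n. Z (r n)) Y sequentially"
    unfolding uniform_limit_iff eventually_sequentially dist_norm using lim by blast
  define V where "V t = fst (snd (Y t))" for t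
  define X where "X t = snd (snd (Y t))" for t
  have Z_pt: "(\<lambda>n. Z (r n) t) \<longlonglongrightarrow> Y t" if "t \<in> {0..T}" for t
    using tendsto_uniform_limitI[OF Z_lim that] .
  have Y_eq: "Y t = (t, V t, X t)" and U_lim: "(\<lambda>n. U (r n) t) \<longlonglongrightarrow> V t"
    and W_lim: "(\<lambda>n. W (r n) t) \<longlonglongrightarrow> X t" if "t \<in> {0..T}" for t
  proof -
    have "(\<lambda>n. fst (Z (r n) t)) \<longlonglongrightarrow> fst (Y t)"
      by (intro tendsto_intros Z_pt that)
    then have "fst (Y t) = t"
      by (simp add: Z_def LIMSEQ_const_iff)
    then show "Y t = (t, V t, X t)"
      by (simp add: V_def X_def prod_eq_iff)
    show "(\<lambda>n. U (r n) t) \<longlonglongrightarrow> V t" "(\<lambda>n. W (r n) t) \<longlonglongrightarrow> X t"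
      using tendsto_fst[OF tendsto_snd[OF Z_pt[OF that]]]
        tendsto_snd[OF tendsto_snd[OF Z_pt[OF that]]] by (simp_all add: Z_def V_def X_def)
  qed
  \<comment> \<open>The limit stays in the compact set on which the right-hand sides are uniformly
    continuous.\<close>
  have Y_mem: "Y t \<in> B" if "t \<in> {0..T}" for t
    by (rule closed_sequentially[OF compact_imp_closed[OF \<open>compact B\<close>] Z_mem[OF that]
          Z_pt[OF that]])

  \<comment> \<open>Passage to the limit in the equations\<close>
  have composed: "uniform_limit {0..T} (\<lambda>n t. g (Z (r n) t)) (\<lambda>t. g (Y t)) sequentially"
      "continuous_on {0..T} (\<lambda>t. g (Y t))"
    if g: "continuous_on B g" for g :: "real \<times> real \<times> real \<Rightarrow> real"
  proof -
    \<comment> \<open>Uniform continuity of \<open>g\<close> on \<open>B\<close> carries uniform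
      convergence over to the compositions.\<close>
    show "uniform_limit {0..T} (\<lambda>n t. g (Z (r n) t)) (\<lambda>t. g (Y t)) sequentially"
      using Z_mem by (intro uniform_limit_compose_uniformly_continuous_on[OF Z_lim,
            OF compact_uniformly_continuous[OF g \<open>compact B\<close>]] compact_imp_closed \<open>compact B\<close>) auto
    show "continuous_on {0..T} (\<lambda>t. g (Y t))"
      using Y_mem by (intro continuous_on_compose2[OF g Y]) auto
  qed
  \<comment> \<open>The two right-hand sides as functions of the single point
    \<open>(t, u, w)\<close>; this is why \<open>Z\<close> carries the time.\<close>
  define g\<^sub>U where "g\<^sub>U z = \<psi> (snd (snd z))" for z :: "real \<times> real \<times> real"
  define g\<^sub>W where "g\<^sub>W z = f (fst z) (fst (snd z)) (\<psi> (snd (snd z)))" for z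
  have gU: "continuous_on B g\<^sub>U"
    unfolding g\<^sub>U_def by (rule continuous_on_compose2[OF \<psi>]) (auto intro!: continuous_intros)
  have "continuous_on B
      (\<lambda>z. case (fst z, fst (snd z), \<psi> (snd (snd z))) of (t, x, y) \<Rightarrow> f t x y)"
    by (intro continuous_on_compose2[OF f] continuous_intros gU[unfolded g\<^sub>U_def])
      (auto simp: B_def)
  then have gW: "continuous_on B g\<^sub>W"
    by (simp add: g\<^sub>W_def)
  have T0: "0 \<in> {0..T}" "T \<in> {0..T}"
    using T by auto
  have hr_lim: "(\<lambda>n. h (r n)) \<longlonglongrightarrow> 0"
    using LIMSEQ_subseq_LIMSEQ[OF h_lim r] by (simp add: o_def)

  have V_deriv: "(V has_real_derivative \<psi> (X t)) (at t within {0..T})" if t: "t \<in> {0..T}" for t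
  proof -
    \<comment> \<open>The polygons vanish at \<open>0\<close>, so their limit is
      \<open>V - V 0\<close>; the constant is added back afterwards.\<close>
    have "((\<lambda>s. V s - V 0) has_real_derivative g\<^sub>U (Y t)) (at t within {0..T})"
    proof (rule polygon_limit_has_derivative[OF h hr_lim composed[OF gU] _ t])
      fix s assume s: "s \<in> {0..T}"
      have "U n s - U n 0 = polygon (h n) (Suc n) (\<lambda>k. g\<^sub>U (Z n (h n * k))) s" for n
        using U[of n s] by (simp add: g\<^sub>U_def Z_def)
      moreover have "(\<lambda>n. U (r n) s - U (r n) 0) \<longlonglongrightarrow> V s - V 0"
        by (intro tendsto_diff U_lim s T0)
      ultimately show "(\<lambda>n. polygon (h (r n)) (Suc (r n)) (\<lambda>k. g\<^sub>U (Z (r n) (h (r n) * k))) s)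
          \<longlonglongrightarrow> V s - V 0"
        by simp
    qed
    then have "((\<lambda>s. V s - V 0 + V 0) has_real_derivative \<psi> (X t) + 0) (at t within {0..T})"
      by (intro DERIV_add DERIV_const) (simp add: g\<^sub>U_def Y_eq[OF t])
    then show ?thesis by simp
  qed
  have X_deriv: "(X has_real_derivative f t (V t) (\<psi> (X t))) (at t within {0..T})"
    if t: "t \<in> {0..T}" for t
  proof -
    have "((\<lambda>s. X s - X 0) has_real_derivative g\<^sub>W (Y t)) (at t within {0..T})"
    proof (rule polygon_limit_has_derivative[OF h hr_lim composed[OF gW] _ t])
      fix s assume s: "s \<in> {0..T}"
      have "W n s - W n 0 = polygon (h n) (Suc n) (\<lambda>k. g\<^sub>W (Z n (h n * k))) s" for n
        using W[of n s] by (simp add: g\<^sub>W_def Z_def)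
      moreover have "(\<lambda>n. W (r n) s - W (r n) 0) \<longlonglongrightarrow> X s - X 0"
        by (intro tendsto_diff W_lim s T0)
      ultimately show "(\<lambda>n. polygon (h (r n)) (Suc (r n)) (\<lambda>k. g\<^sub>W (Z (r n) (h (r n) * k))) s)
          \<longlonglongrightarrow> X s - X 0"
        by simp
    qed
    then have "((\<lambda>s. X s - X 0 + X 0) has_real_derivative f t (V t) (\<psi> (X t)) + 0)
        (at t within {0..T})"
      by (intro DERIV_add DERIV_const) (simp add: g\<^sub>W_def Y_eq[OF t])
    then show ?thesis by simp
  qed
  \<comment> \<open>The boundary conditions hold for every approximation and pass to the limit at
    the points \<open>0\<close> and \<open>T\<close>.\<close>
  have "(\<lambda>n. \<psi> (W (r n) 0)) \<longlonglongrightarrow> \<psi> (X 0)"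
    by (rule continuous_on_tendsto_compose[OF \<psi> W_lim]) (use T0 in auto)
  then have "V 0 = \<psi> (X 0)"
    using LIMSEQ_unique[OF U_lim[OF T0(1)]] by (simp add: U0)
  moreover have "X T = - X 0"
    using LIMSEQ_unique[OF W_lim[OF T0(2)]] tendsto_minus[OF W_lim[OF T0(1)]] by (simp add: WT)
  ultimately show ?thesis
    using that V_deriv X_deriv by blast
qed

end


section \<open>The boundary value problem\<close>

lemma deriv_on_eqI:
  assumes "T > 0" "t \<in> {0..T}" "(u has_real_derivative d) (at t within {0..T})"
  shows "deriv_on T u t = d"
  unfolding deriv_on_def
  using assms by (intro vector_derivative_within_cbox[of 0 T, unfolded box_real])
    (auto simp: has_real_derivative_iff_has_vector_derivative)

lemma C1_onI:
  assumes "T > 0" "continuous_on {0..T} u'"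
    and u: "\<And>t. t \<in> {0..T} \<Longrightarrow> (u has_real_derivative u' t) (at t within {0..T})"
  shows "C1_on T u"
  unfolding C1_on_def
proof
  show "u differentiable_on {0..T}"
    using u unfolding differentiable_on_def real_differentiable_def by blast
  show "continuous_on {0..T} (deriv_on T u)"
    using assms(2) by (rule continuous_on_eq) (metis deriv_on_eqI assms(1) u)
qed

theorem theorem4p3:
  fixes T b :: real and \<phi> :: "real \<Rightarrow> real" and f :: "real \<Rightarrow> real \<Rightarrow> real \<Rightarrow> real"
  assumes "T > 0"
    and "homeomorphism UNIV UNIV \<phi> (inv \<phi>)"
    and "\<And>x. \<phi> (- x) = - \<phi> x"
    and "continuous_on ({0..T} \<times> UNIV \<times> UNIV) (\<lambda>(t, x, y). f t x y)"
    and "b = -1"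
    and "\<exists>h. continuous_on {0..T} h \<and> (\<forall>t\<in>{0..T}. \<forall>x y. \<bar>f t x y\<bar> \<le> h t)"
    and "\<exists>\<rho>>0. brouwer_degree_defined (G_map T \<phi> b f) (affine_ball T \<rho>) 0 \<and>
                brouwer_degree (G_map T \<phi> b f) (affine_ball T \<rho>) 0 \<noteq> 0"
  shows "\<exists>u. is_solution T \<phi> b f u"
proof -
  define \<psi> where "\<psi> = inv \<phi>"
  have \<phi>\<psi>: "\<phi> (\<psi> w) = w" and \<psi>\<phi>: "\<psi> (\<phi> x) = x" for w x
    using assms(2) by (auto simp: homeomorphism_def \<psi>_def)
  have \<psi>: "continuous_on UNIV \<psi>"
    using assms(2) by (simp add: homeomorphism_def \<psi>_def)
  \<comment> \<open>Oddness will turn \<open>W T = - W 0\<close> into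
    \<open>u'(T) = - u'(0)\<close>.\<close>
  have \<psi>_odd: "\<psi> (- w) = - \<psi> w" for w
    using \<psi>\<phi>[of "- \<psi> w"] by (simp add: assms(3) \<phi>\<psi>)
  obtain h where h: "continuous_on {0..T} h" "\<And>t x y. t \<in> {0..T} \<Longrightarrow> \<bar>f t x y\<bar> \<le> h t"
    using assms(6) by blast
  \<comment> \<open>The continuous \<open>h\<close> attains its maximum on the compact interval,
    which gives one constant bound for \<open>f\<close>.\<close>
  obtain M where M: "\<And>t. t \<in> {0..T} \<Longrightarrow> h t \<le> M"
    using continuous_attains_sup[OF _ _ h(1)] assms(1) by fastforce
  obtain U W where start: "U 0 = \<psi> (W 0)" and end_: "W T = - W 0"
    and U: "\<And>t. t \<in> {0..T} \<Longrightarrow> (U has_real_derivative \<psi> (W t)) (at t within {0..T})"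
    and W: "\<And>t. t \<in> {0..T} \<Longrightarrow> (W has_real_derivative f t (U t) (\<psi> (W t))) (at t within {0..T})"
    using antiperiodic_system_solvable[OF assms(1,4) order_trans[OF h(2) M] \<psi>] by blast
  have contU: "continuous_on {0..T} U" and contW: "continuous_on {0..T} W"
    by (rule DERIV_continuous_on, rule U, assumption, rule DERIV_continuous_on, rule W)
  have cont\<psi>W: "continuous_on {0..T} (\<lambda>t. \<psi> (W t))"
    by (rule continuous_on_compose2[OF \<psi> contW]) simp
  have "continuous_on {0..T} (\<lambda>t. case (t, U t, \<psi> (W t)) of (t, x, y) \<Rightarrow> f t x y)"
    by (intro continuous_on_compose2[OF assms(4)] continuous_intros contU cont\<psi>W) auto
  then have cont_f: "continuous_on {0..T} (\<lambda>t. f t (U t) (\<psi> (W t)))"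
    by simp
  have dU: "deriv_on T U t = \<psi> (W t)" if "t \<in> {0..T}" for t
    using deriv_on_eqI[OF assms(1) that U[OF that]] .
  \<comment> \<open>On \<open>[0, T]\<close> the function in question coincides with
    \<open>W\<close>, and derivatives within the interval see only these values.\<close>
  have W': "((\<lambda>t. \<phi> (deriv_on T U t)) has_real_derivative f t (U t) (\<psi> (W t))) (at t within {0..T})"
    if "t \<in> {0..T}" for t
    using W[OF that] that unfolding has_field_derivative_def
    by (elim has_derivative_transform[rotated 2]) (simp_all add: dU \<phi>\<psi>)
  have "is_solution T \<phi> b f U"
    unfolding is_solution_def
  proof (intro conjI ballI)
    show "C1_on T U"
      by (rule C1_onI[OF assms(1) cont\<psi>W U])
    show "C1_on T (\<lambda>t. \<phi> (deriv_on T U t))"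
      by (rule C1_onI[OF assms(1) cont_f W'])
    show "deriv_on T (\<lambda>s. \<phi> (deriv_on T U s)) t = f t (U t) (deriv_on T U t)"
      if "t \<in> {0..T}" for t
      using deriv_on_eqI[OF assms(1) that W'[OF that]] dU[OF that] by simp
    show "deriv_on T U 0 = U 0" "deriv_on T U T = b * deriv_on T U 0"
      using assms(1,5) by (simp_all add: dU start end_ \<psi>_odd)
  qed
  then show ?thesis by blast
qed

end
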